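(* Let $f\in\mathcal{F}_\infty$, let $x^\star$ be a minimizer of $f$ and $f^\star=f(x^\star)$, let $x_0\in\mathbb{R}^n$, and let $X$ be the unique global solution of $$\ddot X(t)+\frac{3}{t}\dot X(t)+\nabla f(X(t))=0\quad (t>0),\qquad X(0)=x_0,\ \dot X(0)=0 .$$ Then for every $t>0$, $$f(X(t))-f^\star\le\frac{2\|x_0-x^\star\|^2}{t^2}.$$
   Context: $\|\cdot\|$ is the Euclidean norm on $\mathbb{R}^n$. For $L>0$, $\mathcal{F}_L$ is the class of convex continuously differentiable functions $f:\mathbb{R}^n\to\mathbb{R}$ with $\|\nabla f(x)-\nabla f(y)\|\le L\|x-y\|$ for all $x,y\in\mathbb{R}^n$, and $\mathcal{F}_\infty=\bigcup_{L>0}\mathcal{F}_L$. The differential equation above has a unique solution in $C^2((0,\infty);\mathbb{R}^n)\cap C^1([0,\infty);\mathbb{R}^n)$ with the given initial conditions; $X$ denotes this solution. *)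

theory Defs
  imports "HOL-Analysis.Analysis"
begin

text \<open>Meaningful only where \<open>f\<close> is differentiable; elsewhere the description is unspecified.\<close>

definition gradient :: "(real ^ 'n \<Rightarrow> real) \<Rightarrow> real ^ 'n \<Rightarrow> real ^ 'n" where
  "gradient f x = (THE D. GDERIV f x :> D)"

definition smooth_convex :: "real \<Rightarrow> (real ^ 'n \<Rightarrow> real) set" where
  "smooth_convex L =
    {f. convex_on UNIV f \<and> (\<forall>x. f differentiable (at x)) \<and> continuous_on UNIV (gradient f) \<and>
        (\<forall>x y. norm (gradient f x - gradient f y) \<le> L * norm (x - y))}"

definition smooth_convex_any :: "(real ^ 'n \<Rightarrow> real) set" where
  "smooth_convex_any = (\<Union>L\<in>{0<..}. smooth_convex L)"

text \<open>
  The trajectory is represented by a total function on the reals, of which only the values on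
  \<open>[0, \<infinity>)\<close> matter. The functions \<open>V\<close> and \<open>A\<close> are its first and second derivatives. The
  derivative at \<open>0\<close> is one-sided, and \<open>V\<close> is continuous up to \<open>0\<close>, so that the trajectory is
  \<open>C\<^sup>1\<close> on \<open>[0, \<infinity>)\<close>; it is \<open>C\<^sup>2\<close> on \<open>(0, \<infinity>)\<close>.
\<close>

definition nesterov_solution ::
  "(real ^ 'n \<Rightarrow> real) \<Rightarrow> real ^ 'n \<Rightarrow> (real \<Rightarrow> real ^ 'n) \<Rightarrow> bool" where
  "nesterov_solution f x0 X \<longleftrightarrow>
    (\<exists>V A.
      (\<forall>t\<ge>0. (X has_vector_derivative V t) (at t within {0..})) \<and> continuous_on {0..} V \<and>
      (\<forall>t>0. (V has_vector_derivative A t) (at t)) \<and> continuous_on {0<..} A \<and>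
      (\<forall>t>0. A t + (3 / t) *\<^sub>R V t + gradient f (X t) = 0) \<and>
      X 0 = x0 \<and> V 0 = 0)"

end

theory Submission
  imports Defs
begin

text \<open>
  Lyapunov argument of Su, Boyd and Candes: along the trajectory, the energy
  \<open>t\<^sup>2 (f (X t) - f x\<^sup>\<star>) + 2 \<parallel>X t + (t / 2) X' t - x\<^sup>\<star>\<parallel>\<^sup>2\<close> has derivative
  \<open>2 t (f (X t) - f x\<^sup>\<star> - \<langle>X t - x\<^sup>\<star>, \<nabla>f (X t)\<rangle>)\<close>, which is nonpositive because the convex function
  lies above its tangents. The energy equals \<open>2 \<parallel>x\<^sub>0 - x\<^sup>\<star>\<parallel>\<^sup>2\<close> at time \<open>0\<close>.
\<close>

text \<open>A linear functional \<open>f'\<close> on a Euclidean space is the inner product with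
  \<open>adjoint f' 1\<close>, so a vector representing the derivative exists. The derivative is
  unique and a vector is determined by its inner products with all \<open>h\<close>, so the
  description defining \<open>gradient\<close> picks out exactly this vector.\<close>

lemma has_derivative_gradient:
  fixes f :: "real ^ 'n \<Rightarrow> real"
  assumes "f differentiable (at x)"
  shows "(f has_derivative (\<lambda>h. h \<bullet> gradient f x)) (at x)"
proof -
  obtain f' where f': "(f has_derivative f') (at x)"
    using assms by (auto simp: differentiable_def)
  have "linear f'"
    using f' by (rule has_derivative_linear)
  then have "f' h = h \<bullet> adjoint f' 1" for h
    using adjoint_works[of f' h 1] by simp
  then have "f' = (\<lambda>h. h \<bullet> adjoint f' 1)" by auto
  then have D: "GDERIV f x :> adjoint f' 1"
    using f' unfolding gderiv_def by simp
  have "GDERIV f x :> gradient f x"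
    unfolding gradient_def
  proof (rule theI[where P = "\<lambda>D. GDERIV f x :> D", OF D])
    fix D'
    assume "GDERIV f x :> D'"
    then have "(\<lambda>h. h \<bullet> D') = (\<lambda>h. h \<bullet> adjoint f' 1)"
      using D unfolding gderiv_def by (rule has_derivative_unique)
    then show "D' = adjoint f' 1"
      by (simp only: fun_eq_iff vector_eq_ldot)
  qed
  then show ?thesis
    unfolding gderiv_def .
qed

text \<open>Restricting \<open>f\<close> to the line through \<open>x\<close> and \<open>y\<close>
  gives a convex function \<open>\<phi>\<close> of one real variable with slope
  \<open>f' (y - x)\<close> at 0. The one-dimensional tangent inequality at 0, evaluated at 1, is
  the claim.\<close>

lemma convex_on_ge_tangent:
  fixes f :: "'a::real_normed_vector \<Rightarrow> real"
  assumes "convex_on UNIV f" and "(f has_derivative f') (at x)"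
  shows "f x + f' (y - x) \<le> f y"
proof -
  define \<phi> where "\<phi> = (\<lambda>s. f (x + s *\<^sub>R (y - x)))"
  have "convex_on UNIV \<phi>"
  proof (rule convex_onI)
    fix t a b :: real
    assume "0 < t" "t < 1"
    moreover have "x + ((1 - t) * a + t * b) *\<^sub>R (y - x) =
        (1 - t) *\<^sub>R (x + a *\<^sub>R (y - x)) + t *\<^sub>R (x + b *\<^sub>R (y - x))"
      by (simp add: algebra_simps)
    ultimately show "\<phi> ((1 - t) *\<^sub>R a + t *\<^sub>R b) \<le> (1 - t) * \<phi> a + t * \<phi> b"
      using convex_onD[OF assms(1), of t "x + a *\<^sub>R (y - x)" "x + b *\<^sub>R (y - x)"]
      by (simp add: \<phi>_def)
  qed simp
  moreover have "(\<phi> has_real_derivative f' (y - x)) (at 0)"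
  proof -
    have "((\<lambda>s. x + s *\<^sub>R (y - x)) has_vector_derivative (y - x)) (at 0)"
      by (auto intro!: derivative_eq_intros)
    then have "((f \<circ> (\<lambda>s. x + s *\<^sub>R (y - x))) has_vector_derivative f' (y - x)) (at 0)"
      by (rule vector_derivative_diff_chain_within)
        (use assms(2) in \<open>auto intro: has_derivative_at_withinI\<close>)
    then show ?thesis
      by (simp add: \<phi>_def o_def has_real_derivative_iff_has_vector_derivative)
  qed
  ultimately have "f' (y - x) * (1 - 0) \<le> \<phi> 1 - \<phi> 0"
    by (intro convex_on_imp_above_tangent[where A = UNIV]) auto
  then show ?thesis
    by (simp add: \<phi>_def)
qed

theorem theorem3:
  fixes f :: "real ^ 'n \<Rightarrow> real" and x0 xstar :: "real ^ 'n" and X :: "real \<Rightarrow> real ^ 'n"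
  assumes "f \<in> smooth_convex_any"
    and "\<forall>y. f xstar \<le> f y"
    and "nesterov_solution f x0 X"
  shows "\<forall>t>0. f (X t) - f xstar \<le> 2 * (norm (x0 - xstar))\<^sup>2 / t\<^sup>2"
proof (intro allI impI)
  fix T :: real
  assume "0 < T"
  have conv: "convex_on UNIV f" and diff: "\<And>x. f differentiable (at x)"
    using assms(1) by (auto simp: smooth_convex_any_def smooth_convex_def)
  note grad = has_derivative_gradient[OF diff]
  obtain V A where
    X: "\<And>t. 0 \<le> t \<Longrightarrow> (X has_vector_derivative V t) (at t within {0..})"
    and V_cont: "continuous_on {0..} V"
    and V: "\<And>t. 0 < t \<Longrightarrow> (V has_vector_derivative A t) (at t)"
    and ode: "\<And>t. 0 < t \<Longrightarrow> A t + (3 / t) *\<^sub>R V t + gradient f (X t) = 0"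
    and init: "X 0 = x0" "V 0 = 0"
    using assms(3) unfolding nesterov_solution_def by blast
  define W where "W = (\<lambda>t. X t + (t / 2) *\<^sub>R V t - xstar)"
  \<comment> \<open>Writing the squared norm as an inner product lets the bilinear product rule
    differentiate it, even where \<open>W t\<close> vanishes.\<close>
  define E where "E = (\<lambda>t. t\<^sup>2 * (f (X t) - f xstar) + 2 * (W t \<bullet> W t))"
  have X_cont: "continuous_on {0..} X"
    using X by (auto simp: continuous_on_eq_continuous_within
        intro: has_vector_derivative_continuous)
  have f_cont: "continuous_on S f" for S
    by (intro continuous_at_imp_continuous_on ballI differentiable_imp_continuous_within diff)
  have "continuous_on {0..} E"
    unfolding E_def W_def
    by (intro continuous_intros X_cont V_cont continuous_on_compose2[OF f_cont X_cont])
      auto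
  then have E_cont: "continuous_on {0..T} E"
    by (rule continuous_on_subset) auto
  have "E T \<le> E 0"
  \<comment> \<open>The equation is singular at 0 and \<open>V\<close> is only known to be
    continuous there, so \<open>E\<close> is differentiated on the open interval and the endpoints
    are reached by continuity.\<close>
  proof (rule DERIV_nonpos_imp_decreasing_open[OF _ _ E_cont])
    show "0 \<le> T" using \<open>0 < T\<close> by simp
    fix t :: real
    assume "0 < t" "t < T"
    let ?g = "gradient f (X t)"
    \<comment> \<open>Since \<open>t\<close> is interior to the half-line, the derivative within
      \<open>{0..}\<close> is a two-sided one.\<close>
    have X': "(X has_vector_derivative V t) (at t)"
      using has_vector_derivative_within_subset[OF X, of t "{0<..}"] \<open>0 < t\<close>
        at_within_open[of t "{0<..}"] by (simp add: subset_eq)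
    have "((\<lambda>s. s / 2) has_real_derivative 1 / 2) (at t)"
      by (auto intro!: derivative_eq_intros)
    then have "(W has_vector_derivative V t + ((t / 2) *\<^sub>R A t + (1 / 2) *\<^sub>R V t)) (at t)"
      unfolding W_def has_vector_derivative_diff_const
      by (intro has_vector_derivative_add has_vector_derivative_scaleR X' V[OF \<open>0 < t\<close>])
    \<comment> \<open>The left side is
      \<open>(t / 2) *\<^sub>R (A t + (3 / t) *\<^sub>R V t)\<close>: the weight
      \<open>t / 2\<close> in \<open>W\<close> is matched to the damping coefficient
      \<open>3 / t\<close>, so the equation leaves only the gradient.\<close>
    moreover have "V t + ((t / 2) *\<^sub>R A t + (1 / 2) *\<^sub>R V t) = - (t / 2) *\<^sub>R ?g"
    proof -
      have "?g = - A t - (3 / t) *\<^sub>R V t"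
        using ode[OF \<open>0 < t\<close>] by (simp add: algebra_simps eq_neg_iff_add_eq_0)
      then show ?thesis
        using \<open>0 < t\<close>
        by (simp add: vec_eq_iff field_simps) (simp add: eq_neg_iff_add_eq_0 ac_simps)
    qed
    ultimately have W': "(W has_vector_derivative - (t / 2) *\<^sub>R ?g) (at t)"
      by simp
    have "((f \<circ> X) has_vector_derivative V t \<bullet> ?g) (at t)"
      by (rule vector_derivative_diff_chain_within[OF X'])
        (rule has_derivative_at_withinI[OF grad])
    then have fX: "((\<lambda>s. f (X s)) has_real_derivative V t \<bullet> ?g) (at t)"
      by (simp add: o_def has_real_derivative_iff_has_vector_derivative)
    have WW: "((\<lambda>s. W s \<bullet> W s) has_real_derivative - t * (W t \<bullet> ?g)) (at t)"
      using bounded_bilinear.has_vector_derivative[OF bounded_bilinear_inner W' W']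
      by (simp add: has_real_derivative_iff_has_vector_derivative inner_commute)
    have "(E has_real_derivative
        2 * t * (f (X t) - f xstar) + t\<^sup>2 * (V t \<bullet> ?g) - 2 * t * (W t \<bullet> ?g)) (at t)"
      unfolding E_def by (rule fX WW derivative_eq_intros refl | simp)+
    \<comment> \<open>The velocity part \<open>(t / 2) *\<^sub>R V t\<close> of \<open>W t\<close>
      contributes \<open>- t\<^sup>2 * (V t \<bullet> ?g)\<close>, which cancels the term from the
      derivative of \<open>f (X t)\<close>. What remains is the tangent of \<open>f\<close> at
      \<open>X t\<close>, evaluated at \<open>xstar\<close>.\<close>
    moreover have "2 * t * (f (X t) - f xstar) + t\<^sup>2 * (V t \<bullet> ?g) - 2 * t * (W t \<bullet> ?g) =
        2 * t * (f (X t) + (xstar - X t) \<bullet> ?g - f xstar)"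
      by (simp add: W_def algebra_simps power2_eq_square)
    moreover have "\<dots> \<le> 0"
      using convex_on_ge_tangent[OF conv grad, of "X t" xstar] \<open>0 < t\<close>
      by (simp add: mult_le_0_iff)
    ultimately show "\<exists>y. (E has_real_derivative y) (at t) \<and> y \<le> 0"
      by (simp only:) blast
  qed
  \<comment> \<open>The squared norm in the energy is nonnegative and is dropped.\<close>
  moreover have "T\<^sup>2 * (f (X T) - f xstar) \<le> E T"
    by (simp add: E_def)
  moreover have "E 0 = 2 * (norm (x0 - xstar))\<^sup>2"
    by (simp add: E_def W_def init power2_norm_eq_inner)
  ultimately show "f (X T) - f xstar \<le> 2 * (norm (x0 - xstar))\<^sup>2 / T\<^sup>2"
    using \<open>0 < T\<close> by (simp add: pos_le_divide_eq mult.commute)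
qed

end
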